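(* If $K$ is a nonmetrizable compact space, then the space $M_1(K)$ is not a Dugundji space; in particular, it is not an absolute retract.
   Context: Compact spaces are Hausdorff. $C(K)$ is the Banach space of continuous real-valued functions on $K$; $M_1(K)$ is the closed unit ball of $C(K)^*$ (identified with the signed Radon measures on $K$ of variation at most $1$), equipped with the weak$^*$ topology. For compact $K\subseteq L$, an extension operator $E:C(K)\to C(L)$ is a bounded linear operator with $Eg|K=g$ for all $g\in C(K)$. A compact space $K$ is a Dugundji space if for every compact space $L$ containing $K$ there is a regular extension operator $E:C(K)\to C(L)$, i.e. an extension operator of norm $1$ preserving constant functions. A compact space $K$ is an absolute retract if $K$ is a retract of every compact space containing $K$. *)

theory Defs
  imports "HOL-Analysis.Analysis"
begin

section \<open>The Banach space of continuous functions on a compact space\<close>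

text \<open>
  Functions are represented extensionally (\<open>undefined\<close> outside the space), as in
  \<^const>\<open>cfunspace\<close>. For compact \<open>X\<close> the set below is the carrier of
  \<open>cfunspace X euclidean_metric\<close>; boundedness is then automatic.
\<close>

definition Cfun :: "'a topology \<Rightarrow> ('a \<Rightarrow> real) set" where
  "Cfun X = {f \<in> extensional (topspace X). continuous_map X euclideanreal f}"

definition Cadd :: "'a topology \<Rightarrow> ('a \<Rightarrow> real) \<Rightarrow> ('a \<Rightarrow> real) \<Rightarrow> 'a \<Rightarrow> real" where
  "Cadd X f g = (\<lambda>x\<in>topspace X. f x + g x)"

definition Cscale :: "'a topology \<Rightarrow> real \<Rightarrow> ('a \<Rightarrow> real) \<Rightarrow> 'a \<Rightarrow> real" where
  "Cscale X c f = (\<lambda>x\<in>topspace X. c * f x)"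

definition Cconst :: "'a topology \<Rightarrow> real \<Rightarrow> 'a \<Rightarrow> real" where
  "Cconst X c = (\<lambda>x\<in>topspace X. c)"

text \<open>The inserted \<open>0\<close> only matters for the empty space.\<close>

definition sup_norm :: "'a topology \<Rightarrow> ('a \<Rightarrow> real) \<Rightarrow> real" where
  "sup_norm X f = Sup (insert 0 ((\<lambda>x. \<bar>f x\<bar>) ` topspace X))"

text \<open>
  Norm of a bounded linear map defined on \<open>Cfun X\<close>, where \<open>N\<close> is the norm of the target
  space (either another space of continuous functions, or the real line).
\<close>

definition operator_norm :: "'a topology \<Rightarrow> ('b \<Rightarrow> real) \<Rightarrow> (('a \<Rightarrow> real) \<Rightarrow> 'b) \<Rightarrow> real" where
  "operator_norm X N T = Inf {B. 0 \<le> B \<and> (\<forall>f\<in>Cfun X. N (T f) \<le> B * sup_norm X f)}"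

section \<open>The dual space, its weak* topology and its closed unit ball\<close>

definition Cdual :: "'a topology \<Rightarrow> (('a \<Rightarrow> real) \<Rightarrow> real) set" where
  "Cdual X = {\<mu> \<in> extensional (Cfun X).
     (\<forall>f\<in>Cfun X. \<forall>g\<in>Cfun X. \<mu> (Cadd X f g) = \<mu> f + \<mu> g) \<and>
     (\<forall>c. \<forall>f\<in>Cfun X. \<mu> (Cscale X c f) = c * \<mu> f) \<and>
     (\<exists>B. \<forall>f\<in>Cfun X. \<bar>\<mu> f\<bar> \<le> B * sup_norm X f)}"

text \<open>The weak* topology is the topology of pointwise convergence on \<open>Cfun X\<close>.\<close>

definition weak_star :: "'a topology \<Rightarrow> (('a \<Rightarrow> real) \<Rightarrow> real) topology" where
  "weak_star X = subtopology (product_topology (\<lambda>f. euclideanreal) (Cfun X)) (Cdual X)"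

definition M1 :: "'a topology \<Rightarrow> (('a \<Rightarrow> real) \<Rightarrow> real) topology" where
  "M1 X = subtopology (weak_star X) {\<mu> \<in> Cdual X. operator_norm X abs \<mu> \<le> 1}"

section \<open>Extension operators, Dugundji spaces and absolute retracts\<close>

definition bounded_operator ::
    "'a topology \<Rightarrow> 'b topology \<Rightarrow> (('a \<Rightarrow> real) \<Rightarrow> 'b \<Rightarrow> real) \<Rightarrow> bool" where
  "bounded_operator X L E \<longleftrightarrow>
     E \<in> Cfun X \<rightarrow> Cfun L \<and>
     (\<forall>f\<in>Cfun X. \<forall>g\<in>Cfun X. E (Cadd X f g) = Cadd L (E f) (E g)) \<and>
     (\<forall>c. \<forall>f\<in>Cfun X. E (Cscale X c f) = Cscale L c (E f)) \<and>
     (\<exists>B. \<forall>f\<in>Cfun X. sup_norm L (E f) \<le> B * sup_norm X f)"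

text \<open>
  A space \<open>L\<close> containing \<open>X\<close> is given as a space \<open>L\<close> together with a topological embedding
  \<open>e\<close> of \<open>X\<close> into \<open>L\<close>.
\<close>

definition extension_operator ::
    "'a topology \<Rightarrow> 'b topology \<Rightarrow> ('a \<Rightarrow> 'b) \<Rightarrow> (('a \<Rightarrow> real) \<Rightarrow> 'b \<Rightarrow> real) \<Rightarrow> bool" where
  "extension_operator X L e E \<longleftrightarrow>
     bounded_operator X L E \<and> (\<forall>g\<in>Cfun X. \<forall>x\<in>topspace X. E g (e x) = g x)"

definition regular_extension_operator ::
    "'a topology \<Rightarrow> 'b topology \<Rightarrow> ('a \<Rightarrow> 'b) \<Rightarrow> (('a \<Rightarrow> real) \<Rightarrow> 'b \<Rightarrow> real) \<Rightarrow> bool" where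
  "regular_extension_operator X L e E \<longleftrightarrow>
     extension_operator X L e E \<and>
     operator_norm X (sup_norm L) E = 1 \<and>
     (\<forall>c. E (Cconst X c) = Cconst L c)"

text \<open>
  HOL cannot quantify over all types, so in the next two definitions \<open>L\<close> ranges over the
  compact spaces on the type \<open>('a \<Rightarrow> real) \<Rightarrow> real\<close>, which carries the Tychonoff cube of a
  space on \<open>'a\<close>. This is no restriction: the theorems \<open>dugundji_space_any_type\<close> and
  \<open>absolute_retract_space_any_type\<close> below give the defining property for spaces \<open>L\<close> on
  an arbitrary type. Both notions are meant for compact Hausdorff \<open>X\<close>.
\<close>

definition dugundji_space :: "'a topology \<Rightarrow> bool" where
  "dugundji_space X \<longleftrightarrow>
     (\<forall>(L :: (('a \<Rightarrow> real) \<Rightarrow> real) topology) e.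
        compact_space L \<and> Hausdorff_space L \<and> embedding_map X L e \<longrightarrow>
        (\<exists>E. regular_extension_operator X L e E))"

definition absolute_retract_space :: "'a topology \<Rightarrow> bool" where
  "absolute_retract_space X \<longleftrightarrow>
     (\<forall>(L :: (('a \<Rightarrow> real) \<Rightarrow> real) topology) e.
        compact_space L \<and> Hausdorff_space L \<and> embedding_map X L e \<longrightarrow>
        (e ` topspace X) retract_of_space L)"

section \<open>Independence of the type of the ambient space\<close>

lemma Cfun_bdd:
  assumes "compact_space X" "f \<in> Cfun X"
  shows "bdd_above (insert 0 ((\<lambda>x. \<bar>f x\<bar>) ` topspace X))"
proof -
  have "compactin euclideanreal (f ` topspace X)"
    using assms unfolding Cfun_def compact_space_def by (blast intro: image_compactin)
  then have "bounded (f ` topspace X)"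
    by (simp add: compact_imp_bounded)
  then obtain b where "\<And>x. x \<in> topspace X \<Longrightarrow> \<bar>f x\<bar> \<le> b"
    by (auto simp: bounded_iff)
  then show ?thesis
    by (intro bdd_aboveI[where M = "max 0 b"]) (force simp: max_def)
qed

lemma sup_norm_ge_0: "compact_space X \<Longrightarrow> f \<in> Cfun X \<Longrightarrow> 0 \<le> sup_norm X f"
  unfolding sup_norm_def by (rule cSup_upper[OF _ Cfun_bdd]) auto

lemma sup_norm_upper:
  "compact_space X \<Longrightarrow> f \<in> Cfun X \<Longrightarrow> x \<in> topspace X \<Longrightarrow> \<bar>f x\<bar> \<le> sup_norm X f"
  unfolding sup_norm_def by (rule cSup_upper[OF _ Cfun_bdd]) auto

lemma sup_norm_least:
  "0 \<le> B \<Longrightarrow> (\<And>x. x \<in> topspace X \<Longrightarrow> \<bar>f x\<bar> \<le> B) \<Longrightarrow> sup_norm X f \<le> B"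
  unfolding sup_norm_def by (rule cSup_least) auto

lemma sup_norm_Cconst:
  assumes "topspace X \<noteq> {}"
  shows "sup_norm X (Cconst X c) = \<bar>c\<bar>"
proof -
  have "insert 0 ((\<lambda>x. \<bar>Cconst X c x\<bar>) ` topspace X) = {0, \<bar>c\<bar>}"
    using assms by (auto simp: Cconst_def image_iff)
  then show ?thesis
    by (simp add: sup_norm_def cSup_eq_Max)
qed

lemma Cconst_in_Cfun: "Cconst X c \<in> Cfun X"
proof -
  have "continuous_map X euclideanreal (\<lambda>x\<in>topspace X. c)"
    by (rule continuous_map_eq[where f = "\<lambda>x. c"]) auto
  then show ?thesis
    by (simp add: Cfun_def Cconst_def)
qed

text \<open>
  For operators preserving constants, norm 1 amounts to the inequality
  \<open>sup_norm L (E f) \<le> sup_norm X f\<close>.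
\<close>

lemma operator_norm_eq_1_iff:
  assumes X: "compact_space X" "topspace X \<noteq> {}" and L: "topspace L \<noteq> {}"
    and B: "\<exists>B. \<forall>f\<in>Cfun X. sup_norm L (E f) \<le> B * sup_norm X f"
    and E: "\<forall>c. E (Cconst X c) = Cconst L c"
  shows "operator_norm X (sup_norm L) E = 1 \<longleftrightarrow> (\<forall>f\<in>Cfun X. sup_norm L (E f) \<le> sup_norm X f)"
proof -
  let ?S = "{B. 0 \<le> B \<and> (\<forall>f\<in>Cfun X. sup_norm L (E f) \<le> B * sup_norm X f)}"
  have ge1: "1 \<le> b" if "b \<in> ?S" for b
  proof -
    have "sup_norm L (E (Cconst X 1)) \<le> b * sup_norm X (Cconst X 1)"
      using that Cconst_in_Cfun by blast
    then show ?thesis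
      using E X L by (simp add: sup_norm_Cconst)
  qed
  obtain B0 where B0: "\<And>f. f \<in> Cfun X \<Longrightarrow> sup_norm L (E f) \<le> B0 * sup_norm X f"
    using B by blast
  have "max 0 B0 \<in> ?S"
    using B0 order_trans[OF B0 mult_right_mono[OF max.cobounded2 sup_norm_ge_0[OF X(1)]]]
    by auto
  then have ne: "?S \<noteq> {}"
    by blast
  show ?thesis
  proof
    assume n1: "operator_norm X (sup_norm L) E = 1"
    show "\<forall>f\<in>Cfun X. sup_norm L (E f) \<le> sup_norm X f"
    proof
      fix f assume f: "f \<in> Cfun X"
      show "sup_norm L (E f) \<le> sup_norm X f"
      proof (rule field_le_epsilon)
        fix e :: real assume "e > 0"
        define d where "d = e / (sup_norm X f + 1)"
        have p: "sup_norm X f \<ge> 0"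
          using f X sup_norm_ge_0 by blast
        then have d: "d > 0"
          using \<open>e > 0\<close> by (simp add: d_def)
        have "Inf ?S < 1 + d"
          using n1 d by (simp add: operator_norm_def)
        then obtain b where b: "b \<in> ?S" "b < 1 + d"
          using cInf_lessD[OF ne] by blast
        have "sup_norm L (E f) \<le> b * sup_norm X f"
          using b f by blast
        also have "\<dots> \<le> (1 + d) * sup_norm X f"
          using b p by (intro mult_right_mono) auto
        also have "\<dots> \<le> sup_norm X f + d * (sup_norm X f + 1)"
          using d by (simp add: algebra_simps)
        also have "d * (sup_norm X f + 1) = e"
          using p by (simp add: d_def)
        finally show "sup_norm L (E f) \<le> sup_norm X f + e" .
      qed
    qed
  next
    assume "\<forall>f\<in>Cfun X. sup_norm L (E f) \<le> sup_norm X f"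
    then have "1 \<in> ?S"
      by auto
    then show "operator_norm X (sup_norm L) E = 1"
      unfolding operator_norm_def using ge1 by (intro cInf_eq_minimum) auto
  qed
qed

lemma regular_extension_operator_nonempty:
  assumes "regular_extension_operator X L e E"
  shows "topspace X \<noteq> {}"
proof
  assume X: "topspace X = {}"
  have S0: "sup_norm X f = 0" for f
    by (simp add: sup_norm_def X)
  have c: "Cconst X 1 = Cconst X 0" and CX: "f = Cconst X 0" if "f \<in> Cfun X" for f
    using that by (auto simp: Cconst_def X Cfun_def extensional_def)
  have E: "E (Cconst X 0) = Cconst L 0" and N: "operator_norm X (sup_norm L) E = 1"
    using assms by (auto simp: regular_extension_operator_def)
  have "sup_norm L (Cconst L 0) = 0"
  proof -
    have "insert 0 ((\<lambda>x. \<bar>Cconst L 0 x\<bar>) ` topspace L) = {0}"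
      by (auto simp: Cconst_def)
    then show ?thesis
      unfolding sup_norm_def by (metis cSup_singleton)
  qed
  then have "\<forall>f\<in>Cfun X. sup_norm L (E f) \<le> B * sup_norm X f" for B
    using CX E S0 by (metis mult_zero_right order_refl)
  then have "operator_norm X (sup_norm L) E = Inf {0..}"
    unfolding operator_norm_def by (simp add: atLeast_def)
  also have "\<dots> = 0"
    by (intro cInf_eq_minimum) auto
  finally show False
    using N by simp
qed

lemma Tychonoff_cube_absorbs:
  fixes X :: "'a topology" and L :: "'b topology"
  assumes X: "compact_space X" "Hausdorff_space X"
    and L: "compact_space L" "Hausdorff_space L" and e: "embedding_map X L e"
  obtains Q :: "(('a \<Rightarrow> real) \<Rightarrow> real) topology" and e0 \<Phi>
  where "compact_space Q" "Hausdorff_space Q" "embedding_map X Q e0"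
    "continuous_map L Q \<Phi>" "\<And>x. x \<in> topspace X \<Longrightarrow> \<Phi> (e x) = e0 x"
proof -
  let ?N = "sup_norm X"
  define Q where "Q = product_topology (\<lambda>f. top_of_set {- ?N f .. ?N f}) (Cfun X)"
  define e0 where "e0 = (\<lambda>x. \<lambda>f\<in>Cfun X. f x)"
  have cQ: "compact_space Q"
    unfolding Q_def compact_space_product_topology
    by (simp add: compact_space_subtopology)
  have hQ: "Hausdorff_space Q"
    unfolding Q_def Hausdorff_space_product_topology
    by (simp add: Hausdorff_space_subtopology)
  have ce0: "continuous_map X Q e0"
    unfolding Q_def continuous_map_componentwise
  proof (intro conjI ballI)
    show "e0 ` topspace X \<subseteq> extensional (Cfun X)"
      by (auto simp: e0_def)
    fix f assume f: "f \<in> Cfun X"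
    have "continuous_map X (top_of_set {- ?N f .. ?N f}) f"
      unfolding continuous_map_in_subtopology
      using f sup_norm_upper[OF X(1) f] by (force simp: Cfun_def abs_le_iff)
    then show "continuous_map X (top_of_set {- ?N f .. ?N f}) (\<lambda>x. e0 x f)"
      using f by (simp add: e0_def)
  qed
  have inj: "inj_on e0 (topspace X)"
  proof (rule inj_onI, rule ccontr)
    fix x y assume xy: "x \<in> topspace X" "y \<in> topspace X" "e0 x = e0 y" "x \<noteq> y"
    have "normal_space X"
      using X compact_Hausdorff_or_regular_imp_normal_space by blast
    moreover have "closedin X {x}" "closedin X {y}"
      using X(2) xy by (auto simp: closedin_Hausdorff_singleton)
    moreover have "disjnt {x} {y}"
      using xy by auto
    ultimately obtain h :: "'a \<Rightarrow> real"
      where h: "continuous_map X (top_of_set {0..1}) h" "h ` {x} \<subseteq> {0}" "h ` {y} \<subseteq> {1}"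
      using Urysohn_lemma[of X "{x}" "{y}" 0 1] by auto
    let ?h = "restrict h (topspace X)"
    have "continuous_map X euclideanreal ?h"
      using h(1) by (auto simp: continuous_map_in_subtopology intro: continuous_map_eq)
    then have "?h \<in> Cfun X"
      by (simp add: Cfun_def)
    then have "?h x = ?h y"
      using xy(3) unfolding e0_def by (metis restrict_apply)
    then show False
      using h xy by auto
  qed
  have emb: "embedding_map X Q e0"
    using continuous_imp_embedding_map[OF ce0 X(1) hQ inj] .
  have nL: "normal_space L"
    using L compact_Hausdorff_or_regular_imp_normal_space by blast
  have ce: "continuous_map X L e"
    using e homeomorphic_imp_continuous_map[of X "subtopology L (e ` topspace X)" e]
    unfolding embedding_map_def continuous_map_in_subtopology by blast
  have clo: "closedin L (e ` topspace X)"
    using continuous_imp_closed_map[OF ce X(1) L(2)] by (simp add: closed_map_def)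
  obtain d where d: "homeomorphic_maps X (subtopology L (e ` topspace X)) e d"
    using e by (auto simp: embedding_map_def homeomorphic_map_maps)
  have "\<exists>g. continuous_map L euclideanreal g \<and> (\<forall>y\<in>e ` topspace X. g y = f (d y)) \<and>
            g ` topspace L \<subseteq> {- ?N f .. ?N f}" if f: "f \<in> Cfun X" for f
  proof -
    have "continuous_map (subtopology L (e ` topspace X)) euclideanreal (f \<circ> d)"
      using d f by (auto simp: homeomorphic_maps_def Cfun_def intro: continuous_map_compose)
    moreover have "(f \<circ> d) ` (e ` topspace X) \<subseteq> {- ?N f .. ?N f}"
      using d sup_norm_upper[OF X(1) f] by (force simp: homeomorphic_maps_def abs_le_iff)
    moreover have "- ?N f \<le> ?N f"
      using sup_norm_ge_0[OF X(1) f] by simp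
    ultimately show ?thesis
      using Tietze_extension_closed_real_interval[OF nL clo] by (metis comp_apply)
  qed
  then obtain F where F: "\<And>f. f \<in> Cfun X \<Longrightarrow> continuous_map L euclideanreal (F f)"
      "\<And>f y. f \<in> Cfun X \<Longrightarrow> y \<in> e ` topspace X \<Longrightarrow> F f y = f (d y)"
      "\<And>f. f \<in> Cfun X \<Longrightarrow> F f ` topspace L \<subseteq> {- ?N f .. ?N f}"
    by metis
  define \<Phi> where "\<Phi> = (\<lambda>y. \<lambda>f\<in>Cfun X. F f y)"
  have cPhi: "continuous_map L Q \<Phi>"
    unfolding Q_def continuous_map_componentwise
  proof (intro conjI ballI)
    show "\<Phi> ` topspace L \<subseteq> extensional (Cfun X)"
      by (auto simp: \<Phi>_def)
    fix f assume f: "f \<in> Cfun X"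
    have "continuous_map L (top_of_set {- ?N f .. ?N f}) (F f)"
      unfolding continuous_map_in_subtopology using F f by blast
    then show "continuous_map L (top_of_set {- ?N f .. ?N f}) (\<lambda>x. \<Phi> x f)"
      using f by (simp add: \<Phi>_def)
  qed
  have "\<Phi> (e x) = e0 x" if "x \<in> topspace X" for x
    using that F(2) d by (auto simp: \<Phi>_def e0_def homeomorphic_maps_def restrict_def)
  with cQ hQ emb cPhi show thesis
    using that by blast
qed

theorem dugundji_space_any_type:
  fixes X :: "'a topology" and L :: "'b topology"
  assumes X: "compact_space X" "Hausdorff_space X" and D: "dugundji_space X"
    and L: "compact_space L" "Hausdorff_space L" and e: "embedding_map X L e"
  shows "\<exists>E. regular_extension_operator X L e E"
proof -
  obtain Q :: "(('a \<Rightarrow> real) \<Rightarrow> real) topology" and e0 \<Phi>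
    where Q: "compact_space Q" "Hausdorff_space Q" "embedding_map X Q e0"
      and Phi: "continuous_map L Q \<Phi>" "\<And>x. x \<in> topspace X \<Longrightarrow> \<Phi> (e x) = e0 x"
    using Tychonoff_cube_absorbs[OF X L e] by metis
  obtain E where E: "regular_extension_operator X Q e0 E"
    using D Q unfolding dugundji_space_def by blast
  define E' where "E' = (\<lambda>f. \<lambda>y\<in>topspace L. E f (\<Phi> y))"
  have PhiQ: "\<Phi> y \<in> topspace Q" if "y \<in> topspace L" for y
    using Phi(1) that by (auto simp: continuous_map_def)
  have eL: "e x \<in> topspace L" if "x \<in> topspace X" for x
    using e that by (force simp: embedding_map_def dest: homeomorphic_imp_surjective_map)
  have ne: "topspace X \<noteq> {}"
    using E by (rule regular_extension_operator_nonempty)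
  then have neL: "topspace L \<noteq> {}"
    using eL by blast
  then have neQ: "topspace Q \<noteq> {}"
    using PhiQ by blast
  have EC: "E f \<in> Cfun Q" if "f \<in> Cfun X" for f
    using E that unfolding regular_extension_operator_def extension_operator_def
      bounded_operator_def by blast
  have Ele: "sup_norm Q (E f) \<le> sup_norm X f" if "f \<in> Cfun X" for f
    using operator_norm_eq_1_iff[OF X(1) ne neQ, of E] E that
    unfolding regular_extension_operator_def extension_operator_def bounded_operator_def
    by blast
  have E'C: "E' f \<in> Cfun L" if f: "f \<in> Cfun X" for f
  proof -
    have "continuous_map Q euclideanreal (E f)"
      using EC[OF f] by (simp add: Cfun_def)
    then have "continuous_map L euclideanreal (E f \<circ> \<Phi>)"
      using Phi(1) continuous_map_compose by blast
    then have "continuous_map L euclideanreal (E' f)"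
      by (rule continuous_map_eq) (simp add: E'_def)
    then show ?thesis
      by (simp add: Cfun_def E'_def)
  qed
  have E'le: "sup_norm L (E' f) \<le> sup_norm X f" if f: "f \<in> Cfun X" for f
  proof (rule sup_norm_least)
    show "0 \<le> sup_norm X f"
      using X f sup_norm_ge_0 by blast
    fix y assume y: "y \<in> topspace L"
    have "\<bar>E f (\<Phi> y)\<bar> \<le> sup_norm Q (E f)"
      using sup_norm_upper[OF Q(1) EC[OF f] PhiQ[OF y]] .
    then show "\<bar>E' f y\<bar> \<le> sup_norm X f"
      using Ele[OF f] y by (simp add: E'_def)
  qed
  have bdd: "\<exists>B. \<forall>f\<in>Cfun X. sup_norm L (E' f) \<le> B * sup_norm X f"
    using E'le by (intro exI[of _ 1]) auto
  have const: "\<forall>c. E' (Cconst X c) = Cconst L c"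
  proof
    fix c
    have "E (Cconst X c) = Cconst Q c"
      using E by (simp add: regular_extension_operator_def)
    then show "E' (Cconst X c) = Cconst L c"
      using PhiQ by (auto simp: E'_def Cconst_def restrict_def)
  qed
  have "operator_norm X (sup_norm L) E' = 1"
    using operator_norm_eq_1_iff[OF X(1) ne neL bdd const] E'le by blast
  moreover have "E' (Cadd X f g) = Cadd L (E' f) (E' g)" if "f \<in> Cfun X" "g \<in> Cfun X" for f g
  proof -
    have "E (Cadd X f g) = Cadd Q (E f) (E g)"
      using E that unfolding regular_extension_operator_def extension_operator_def
        bounded_operator_def by blast
    then show ?thesis
      using PhiQ by (auto simp: E'_def Cadd_def restrict_def)
  qed
  moreover have "E' (Cscale X c f) = Cscale L c (E' f)" if "f \<in> Cfun X" for c f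
  proof -
    have "E (Cscale X c f) = Cscale Q c (E f)"
      using E that unfolding regular_extension_operator_def extension_operator_def
        bounded_operator_def by blast
    then show ?thesis
      using PhiQ by (auto simp: E'_def Cscale_def restrict_def)
  qed
  moreover have "E' g (e x) = g x" if "g \<in> Cfun X" "x \<in> topspace X" for g x
    using E that Phi(2) eL
    by (simp add: E'_def regular_extension_operator_def extension_operator_def)
  ultimately have "regular_extension_operator X L e E'"
    using E'C bdd const
    by (auto simp: regular_extension_operator_def extension_operator_def bounded_operator_def)
  then show ?thesis
    by blast
qed

theorem absolute_retract_space_any_type:
  fixes X :: "'a topology" and L :: "'b topology"
  assumes X: "compact_space X" "Hausdorff_space X" and A: "absolute_retract_space X"
    and L: "compact_space L" "Hausdorff_space L" and e: "embedding_map X L e"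
  shows "(e ` topspace X) retract_of_space L"
proof -
  obtain Q :: "(('a \<Rightarrow> real) \<Rightarrow> real) topology" and e0 \<Phi>
    where Q: "compact_space Q" "Hausdorff_space Q" "embedding_map X Q e0"
      and Phi: "continuous_map L Q \<Phi>" "\<And>x. x \<in> topspace X \<Longrightarrow> \<Phi> (e x) = e0 x"
    using Tychonoff_cube_absorbs[OF X L e] by metis
  have "(e0 ` topspace X) retract_of_space Q"
    using A Q unfolding absolute_retract_space_def by blast
  then obtain r where r: "continuous_map Q (subtopology Q (e0 ` topspace X)) r"
      "\<And>z. z \<in> e0 ` topspace X \<Longrightarrow> r z = z"
    unfolding retract_of_space_def by blast
  obtain d0 where d0: "homeomorphic_maps X (subtopology Q (e0 ` topspace X)) e0 d0"
    using Q(3) by (auto simp: embedding_map_def homeomorphic_map_maps)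
  have ce: "continuous_map X (subtopology L (e ` topspace X)) e"
    using e by (simp add: embedding_map_def homeomorphic_imp_continuous_map)
  have "continuous_map L (subtopology L (e ` topspace X)) (e \<circ> (d0 \<circ> (r \<circ> \<Phi>)))"
    using ce d0 r(1) Phi(1) unfolding homeomorphic_maps_def
    by (blast intro: continuous_map_compose)
  moreover have "(e \<circ> (d0 \<circ> (r \<circ> \<Phi>))) y = y" if "y \<in> e ` topspace X" for y
    using that Phi(2) r(2) d0 by (auto simp: homeomorphic_maps_def)
  moreover have "e ` topspace X \<subseteq> topspace L"
    using ce by (auto simp: continuous_map_in_subtopology continuous_map_def)
  ultimately show ?thesis
    unfolding retract_of_space_def by blast
qed

end

theory Submission
  imports Defs
begin

text \<open>
  \<^bold>\<open>Reduction to retractions.\<close> The ball \<open>M1 K\<close> is a closed subset of the cube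
  \<open>dual_cube K\<close>, the product of the intervals \<open>[- sup_norm K f, sup_norm K f]\<close> over \<open>f \<in> Cfun K\<close>.
  If \<open>M1 K\<close> is an absolute retract, there is a retraction of the cube onto it. If \<open>M1 K\<close> is only
  Dugundji, a regular extension operator \<open>E\<close> assigns to each point \<open>z\<close> of the cube a probability
  measure on the compact convex set \<open>M1 K\<close>, and taking the barycentre of that measure is again a
  retraction (\<open>dugundji_M1_retraction\<close>). So it suffices to show that a nonmetrizable \<open>K\<close> admits no
  retraction \<open>R\<close> of the cube onto \<open>M1 K\<close>.

  \<^bold>\<open>Countably many coordinates.\<close> Each coordinate of \<open>R\<close> is a real continuous function on a product of
  compact spaces, hence depends on countably many coordinates. Closing off, every countable subset of
  \<open>Cfun K\<close> lies in a countable set \<open>A\<close> such that the coordinates of \<open>R z\<close> in \<open>A\<close> depend only on the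
  coordinates of \<open>z\<close> in \<open>A\<close> (\<open>countable_self_supporting_coordinates\<close>). As \<open>K\<close> is not metrizable,
  \<open>A\<close> fails to separate some points \<open>x \<noteq> y\<close>, so that the measure \<open>\<mu> = (\<delta>\<^sub>x - \<delta>\<^sub>y) / 2\<close> vanishes on \<open>A\<close>.

  \<^bold>\<open>The contradiction.\<close> For \<open>s, t \<in> K\<close> let \<open>z s t\<close> be the point of the cube that agrees with
  \<open>(\<delta>\<^sub>s - \<delta>\<^sub>t) / 2\<close> on the coordinates in \<open>A\<close> and with \<open>\<mu>\<close> on the others. On \<open>A\<close> the functional
  \<open>R (z s t)\<close> coincides with \<open>(\<delta>\<^sub>s - \<delta>\<^sub>t) / 2\<close>, whereas \<open>R (z c c) = R \<mu> = \<mu>\<close>. Suppose \<open>A\<close> contains bump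
  functions \<open>g\<^sub>n\<close> at points \<open>a\<^sub>n\<close> with pairwise disjoint carriers. Then \<open>R (z a\<^sub>n a\<^sub>m)\<close> has norm
  at most 1 and already uses all of its variation on \<open>g\<^sub>n\<close> and \<open>g\<^sub>m\<close>, so it kills every function that
  vanishes on their carriers. If \<open>h\<close> is such a function for all \<open>n\<close>, with \<open>h x = 1\<close> and \<open>h y = 0\<close>,
  then \<open>R (z a\<^sub>n a\<^sub>m) h = 0\<close> for \<open>n \<noteq> m\<close>; at an accumulation point \<open>c\<close> of the \<open>a\<^sub>n\<close> continuity gives
  \<open>0 = R (z c c) h = \<mu> h = 1/2\<close> (\<open>no_retraction_with_bumps\<close>).

  \<^bold>\<open>Choosing the bumps.\<close> They have to be put into \<open>A\<close> before \<open>x\<close> and \<open>y\<close> are known. Not being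
  metrizable, \<open>K\<close> is not discrete. If \<open>K\<close> has two nonisolated points \<open>p\<close> and \<open>q\<close>, one takes bumps near
  \<open>p\<close>, bumps near \<open>q\<close>, and a function separating the two neighbourhoods; as \<open>x\<close> and \<open>y\<close> are not told
  apart by the latter, they both stay away from one of the two families. If \<open>p\<close> is the only nonisolated point, then one of \<open>x\<close>, \<open>y\<close> is isolated,
  its indicator function serves as \<open>h\<close>, and at most one bump has to be discarded.
\<close>

section \<open>Continuous functions on a product of compact spaces\<close>

text \<open>
  By continuity every point lies in a basic open box, restricting finitely many coordinates, on which
  \<open>F\<close> oscillates by less than \<open>e\<close>. By compactness finitely many boxes suffice, and two points with the
  same coordinates in all the restricted directions lie in a common box.
\<close>

lemma continuous_on_compact_product_finite_support:
  assumes X: "\<And>i. i \<in> I \<Longrightarrow> compact_space (X i)"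
    and F: "continuous_map (product_topology X I) euclideanreal F"
    and e: "e > 0"
  shows "\<exists>J. finite J \<and> J \<subseteq> I \<and>
    (\<forall>z\<in>topspace (product_topology X I). \<forall>w\<in>topspace (product_topology X I).
      (\<forall>i\<in>J. z i = w i) \<longrightarrow> \<bar>F z - F w\<bar> < e)"
proof -
  let ?P = "product_topology X I"
  \<comment> \<open>\<open>supp U J\<close>: membership in \<open>U\<close> is decided by the finitely many coordinates in \<open>J\<close>.\<close>
  define supp where "supp = (\<lambda>U J. finite J \<and> J \<subseteq> I \<and>
     (\<forall>z\<in>U. \<forall>w\<in>topspace ?P. (\<forall>i\<in>J. z i = w i) \<longrightarrow> w \<in> U))"
  define \<U> where "\<U> = {U. openin ?P U \<and> (\<forall>z\<in>U. \<forall>w\<in>U. \<bar>F z - F w\<bar> < e) \<and> (\<exists>J. supp U J)}"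
  have "topspace ?P \<subseteq> \<Union>\<U>"
  proof
    fix z assume z: "z \<in> topspace ?P"
    let ?V = "{w \<in> topspace ?P. F w \<in> ball (F z) (e/2)}"
    have "openin ?P ?V"
      using F by (rule openin_continuous_map_preimage) auto
    moreover have "z \<in> ?V"
      using z e by simp
    ultimately have "\<exists>B. z \<in> PiE I B \<and> (\<forall>i. openin (X i) (B i)) \<and>
        finite {i. B i \<noteq> topspace (X i)} \<and> PiE I B \<subseteq> ?V"
      by (rule product_topology_open_contains_basis)
    then obtain B where B: "z \<in> PiE I B" "\<And>i. openin (X i) (B i)"
        "finite {i. B i \<noteq> topspace (X i)}" "PiE I B \<subseteq> ?V"
      by blast
    have "\<bar>F u - F w\<bar> < e" if "u \<in> PiE I B" "w \<in> PiE I B" for u w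
    proof -
      have "u \<in> ?V" "w \<in> ?V"
        using that B(4) by blast+
      then have "\<bar>F z - F u\<bar> < e/2" "\<bar>F z - F w\<bar> < e/2"
        by (simp_all add: dist_real_def)
      then show ?thesis
        by linarith
    qed
    moreover have "openin ?P (PiE I B)"
      using B by (intro product_topology_basis) auto
    moreover have "w \<in> PiE I B"
      if "u \<in> PiE I B" "w \<in> topspace ?P" "\<forall>i\<in>{i \<in> I. B i \<noteq> topspace (X i)}. u i = w i" for u w
    proof (rule PiE_I)
      fix i assume i: "i \<in> I"
      show "w i \<in> B i"
        using that i by (cases "B i = topspace (X i)") (force simp: PiE_iff)+
    next
      fix i assume "i \<notin> I"
      then show "w i = undefined"
        using that(2) by (auto simp: PiE_iff extensional_def)
    qed
    then have "supp (PiE I B) {i \<in> I. B i \<noteq> topspace (X i)}"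
      unfolding supp_def using B(3) by (auto elim: rev_finite_subset)
    ultimately have "PiE I B \<in> \<U>"
      unfolding \<U>_def by blast
    then show "z \<in> \<Union>\<U>"
      using B(1) by blast
  qed
  moreover have "compactin ?P (topspace ?P)"
    using X compact_space_product_topology[of X I] by (simp add: compact_space_def)
  ultimately obtain \<F> where \<F>: "finite \<F>" "\<F> \<subseteq> \<U>" "topspace ?P \<subseteq> \<Union>\<F>"
    unfolding compactin_def \<U>_def by (metis (no_types, lifting) mem_Collect_eq)
  have "\<forall>U\<in>\<F>. \<exists>J. supp U J"
    using \<F>(2) by (auto simp: \<U>_def)
  then obtain s where s: "\<And>U. U \<in> \<F> \<Longrightarrow> supp U (s U)"
    by metis
  show ?thesis
  proof (intro exI[of _ "\<Union>(s ` \<F>)"] conjI ballI impI)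
    show "finite (\<Union>(s ` \<F>))" "\<Union>(s ` \<F>) \<subseteq> I"
      using s \<F>(1) by (auto simp: supp_def)
    fix z w assume zw: "z \<in> topspace ?P" "w \<in> topspace ?P" "\<forall>i\<in>\<Union>(s ` \<F>). z i = w i"
    obtain U where U: "U \<in> \<F>" "z \<in> U"
      using \<F>(3) zw(1) by blast
    then have "w \<in> U"
      using s[OF U(1)] zw unfolding supp_def by (metis UN_I)
    then show "\<bar>F z - F w\<bar> < e"
      using U \<F>(2) by (auto simp: \<U>_def)
  qed
qed

lemma continuous_on_compact_product_countable_support:
  assumes X: "\<And>i. i \<in> I \<Longrightarrow> compact_space (X i)"
    and F: "continuous_map (product_topology X I) euclideanreal F"
  shows "\<exists>J. countable J \<and> J \<subseteq> I \<and>
    (\<forall>z\<in>topspace (product_topology X I). \<forall>w\<in>topspace (product_topology X I).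
      (\<forall>i\<in>J. z i = w i) \<longrightarrow> F z = F w)"
proof -
  let ?P = "product_topology X I"
  define supp where "supp = (\<lambda>n J. finite J \<and> J \<subseteq> I \<and>
     (\<forall>z\<in>topspace ?P. \<forall>w\<in>topspace ?P.
        (\<forall>i\<in>J. z i = w i) \<longrightarrow> \<bar>F z - F w\<bar> < inverse (real (Suc n))))"
  have "\<exists>J. supp n J" for n
    unfolding supp_def by (rule continuous_on_compact_product_finite_support[OF X F]) auto
  then obtain J where supp: "\<And>n. supp n (J n)"
    by metis
  then have J: "finite (J n)" "J n \<subseteq> I" for n
    by (simp_all add: supp_def)
  show ?thesis
  proof (intro exI[of _ "\<Union>n. J n"] conjI ballI impI)
    show "countable (\<Union>n. J n)" "(\<Union>n. J n) \<subseteq> I"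
      using J by (auto intro: countable_finite)
    fix z w assume "z \<in> topspace ?P" "w \<in> topspace ?P" "\<forall>i\<in>(\<Union>n. J n). z i = w i"
    then have "\<bar>F z - F w\<bar> < inverse (real (Suc n))" for n
      using supp[of n] unfolding supp_def by (metis UN_I UNIV_I)
    then have "\<not> 0 < \<bar>F z - F w\<bar>"
      using reals_Archimedean not_less_iff_gr_or_eq by blast
    then show "F z = F w"
      by simp
  qed
qed

definition self_supporting ::
    "('i \<Rightarrow> 'b) topology \<Rightarrow> (('i \<Rightarrow> 'b) \<Rightarrow> 'i \<Rightarrow> 'c) \<Rightarrow> 'i set \<Rightarrow> bool" where
  "self_supporting Q R A \<longleftrightarrow>
     (\<forall>z\<in>topspace Q. \<forall>w\<in>topspace Q. (\<forall>i\<in>A. z i = w i) \<longrightarrow> (\<forall>i\<in>A. R z i = R w i))"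

text \<open>
  Adding to a set of coordinates the countable supports of its members, and iterating this countably
  often, produces a countable set that is closed under taking supports.
\<close>

lemma countable_self_supporting_coordinates:
  assumes X: "\<And>i. i \<in> I \<Longrightarrow> compact_space (X i)"
    and R: "\<And>i. i \<in> I \<Longrightarrow> continuous_map (product_topology X I) euclideanreal (\<lambda>z. R z i)"
    and A0: "countable A0" "A0 \<subseteq> I"
  shows "\<exists>A. countable A \<and> A0 \<subseteq> A \<and> A \<subseteq> I \<and>
    self_supporting (product_topology X I) R A"
proof -
  let ?P = "product_topology X I"
  define supp where "supp = (\<lambda>i J. countable J \<and> J \<subseteq> I \<and>
     (\<forall>z\<in>topspace ?P. \<forall>w\<in>topspace ?P. (\<forall>k\<in>J. z k = w k) \<longrightarrow> R z i = R w i))"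
  have "\<exists>J. supp i J" if i: "i \<in> I" for i
    unfolding supp_def by (rule continuous_on_compact_product_countable_support[OF X R[OF i]]) auto
  then obtain s where supp: "\<And>i. i \<in> I \<Longrightarrow> supp i (s i)"
    by metis
  then have s: "countable (s i)" "s i \<subseteq> I" if "i \<in> I" for i
    using that by (simp_all add: supp_def)
  define B where "B = rec_nat A0 (\<lambda>_ S. S \<union> \<Union>(s ` S))"
  have B0: "B 0 = A0" and BS: "\<And>n. B (Suc n) = B n \<union> \<Union>(s ` B n)"
    by (simp_all add: B_def)
  have B: "countable (B n) \<and> B n \<subseteq> I" for n
  proof (induction n)
    case 0
    then show ?case
      using A0 by (simp add: B0)
  next
    case (Suc n)
    then have "\<And>i. i \<in> B n \<Longrightarrow> countable (s i) \<and> s i \<subseteq> I"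
      using s(1,2) by blast
    then show ?case
      using Suc by (auto simp: BS)
  qed
  show ?thesis
    unfolding self_supporting_def
  proof (intro exI[of _ "\<Union>n. B n"] conjI ballI impI)
    show "countable (\<Union>n. B n)" "A0 \<subseteq> (\<Union>n. B n)" "(\<Union>n. B n) \<subseteq> I"
      using B B0 by auto
    fix i z w assume "i \<in> (\<Union>n. B n)" and zw: "z \<in> topspace ?P" "w \<in> topspace ?P"
      "\<forall>k\<in>(\<Union>n. B n). z k = w k"
    then obtain n where n: "i \<in> B n"
      by blast
    then have "\<forall>k\<in>s i. z k = w k"
      using zw(3) BS by blast
    then show "R z i = R w i"
      using supp[of i] n B zw(1,2) by (auto simp: supp_def)
  qed
qed

section \<open>The dual ball as a closed subset of a cube\<close>

definition dual_cube :: "'a topology \<Rightarrow> (('a \<Rightarrow> real) \<Rightarrow> real) topology" where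
  "dual_cube K = product_topology (\<lambda>f. top_of_set {- sup_norm K f .. sup_norm K f}) (Cfun K)"

lemma topspace_dual_cube:
  "topspace (dual_cube K) = (\<Pi>\<^sub>E f\<in>Cfun K. {- sup_norm K f .. sup_norm K f})"
  by (simp add: dual_cube_def topspace_product_topology)

lemma dual_cube_eq_subtopology:
  "dual_cube K = subtopology (product_topology (\<lambda>f. euclideanreal) (Cfun K)) (topspace (dual_cube K))"
  unfolding topspace_dual_cube by (simp add: dual_cube_def subtopology_product_topology)

lemma compact_space_dual_cube: "compact_space (dual_cube K)"
  unfolding dual_cube_def compact_space_product_topology by (simp add: compact_space_subtopology)

lemma Hausdorff_space_dual_cube: "Hausdorff_space (dual_cube K)"
  unfolding dual_cube_def Hausdorff_space_product_topology
  by (simp add: Hausdorff_space_subtopology)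

lemma continuous_map_dual_cube_eval:
  assumes "f \<in> Cfun K"
  shows "continuous_map (dual_cube K) euclideanreal (\<lambda>z. z f)"
  unfolding dual_cube_def
  using continuous_map_product_projection[OF assms, of "\<lambda>f. top_of_set {- sup_norm K f .. sup_norm K f}"]
  by (auto simp: continuous_map_in_subtopology)

lemma continuous_map_into_dual_cube:
  assumes "\<And>t. t \<in> topspace X \<Longrightarrow> G t \<in> topspace (dual_cube K)"
    and "\<And>f. f \<in> Cfun K \<Longrightarrow> continuous_map X euclideanreal (\<lambda>t. G t f)"
  shows "continuous_map X (dual_cube K) G"
proof -
  have sub: "G ` topspace X \<subseteq> topspace (dual_cube K)"
    using assms(1) by blast
  moreover have "G ` topspace X \<subseteq> extensional (Cfun K)"
    using sub by (auto simp: topspace_dual_cube PiE_iff)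
  then have "continuous_map X (product_topology (\<lambda>f. euclideanreal) (Cfun K)) G"
    unfolding continuous_map_componentwise using assms(2) by blast
  ultimately have "continuous_map X (subtopology (product_topology (\<lambda>f. euclideanreal) (Cfun K))
      (topspace (dual_cube K))) G"
    by (simp add: continuous_map_in_subtopology image_subset_iff_funcset)
  then show ?thesis
    by (simp only: dual_cube_eq_subtopology[symmetric])
qed

lemma restrict_in_Cfun:
  assumes "continuous_map K euclideanreal f"
  shows "restrict f (topspace K) \<in> Cfun K"
  using continuous_map_eq[OF assms, of "restrict f (topspace K)"] by (simp add: Cfun_def)

lemma Cadd_in_Cfun: "\<lbrakk>f \<in> Cfun K; g \<in> Cfun K\<rbrakk> \<Longrightarrow> Cadd K f g \<in> Cfun K"
  unfolding Cadd_def by (rule restrict_in_Cfun) (simp add: Cfun_def continuous_map_add)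

lemma Cscale_in_Cfun: "f \<in> Cfun K \<Longrightarrow> Cscale K c f \<in> Cfun K"
  unfolding Cscale_def by (rule restrict_in_Cfun) (simp add: Cfun_def continuous_map_real_mult_left)

lemma operator_norm_abs_le_1_iff:
  assumes K: "compact_space K" and B: "\<forall>f\<in>Cfun K. \<bar>\<mu> f\<bar> \<le> B * sup_norm K f"
  shows "operator_norm K abs \<mu> \<le> 1 \<longleftrightarrow> (\<forall>f\<in>Cfun K. \<bar>\<mu> f\<bar> \<le> sup_norm K f)"
proof -
  let ?S = "{B. 0 \<le> B \<and> (\<forall>f\<in>Cfun K. \<bar>\<mu> f\<bar> \<le> B * sup_norm K f)}"
  have bdd: "bdd_below ?S"
    by (auto intro: bdd_belowI)
  have "max 0 B \<in> ?S"
    using B order_trans[OF _ mult_right_mono[OF max.cobounded2 sup_norm_ge_0[OF K]]] by auto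
  then have ne: "?S \<noteq> {}"
    by blast
  show ?thesis
  proof
    assume le1: "operator_norm K abs \<mu> \<le> 1"
    show "\<forall>f\<in>Cfun K. \<bar>\<mu> f\<bar> \<le> sup_norm K f"
    proof
      fix f assume f: "f \<in> Cfun K"
      have p: "sup_norm K f \<ge> 0"
        using f K sup_norm_ge_0 by blast
      show "\<bar>\<mu> f\<bar> \<le> sup_norm K f"
      proof (cases "sup_norm K f = 0")
        case True
        then show ?thesis
          using B f by force
      next
        case False
        then have "\<bar>\<mu> f\<bar> / sup_norm K f \<le> b" if "b \<in> ?S" for b
          using that f p by (simp add: divide_le_eq)
        then have "\<bar>\<mu> f\<bar> / sup_norm K f \<le> Inf ?S"
          using ne by (intro cInf_greatest)
        then have "\<bar>\<mu> f\<bar> / sup_norm K f \<le> 1"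
          using le1 by (simp add: operator_norm_def)
        then show ?thesis
          using False p by (simp add: divide_le_eq)
      qed
    qed
  next
    assume "\<forall>f\<in>Cfun K. \<bar>\<mu> f\<bar> \<le> sup_norm K f"
    then have "1 \<in> ?S"
      by auto
    then show "operator_norm K abs \<mu> \<le> 1"
      unfolding operator_norm_def using bdd by (rule cInf_lower)
  qed
qed

lemma topspace_M1_Cdual: "topspace (M1 K) = {\<mu> \<in> Cdual K. operator_norm K abs \<mu> \<le> 1}"
  by (auto simp: M1_def weak_star_def Cdual_def PiE_def)

text \<open>
  Points of the cube satisfy the norm estimate by construction, so only linearity remains to be
  imposed. Linearity is a closed condition on coordinates, which makes \<open>M1 K\<close> compact.
\<close>

lemma topspace_M1:
  assumes K: "compact_space K"
  shows "topspace (M1 K) = {\<mu> \<in> topspace (dual_cube K).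
     (\<forall>f\<in>Cfun K. \<forall>g\<in>Cfun K. \<mu> (Cadd K f g) = \<mu> f + \<mu> g) \<and>
     (\<forall>c. \<forall>f\<in>Cfun K. \<mu> (Cscale K c f) = c * \<mu> f)}" (is "_ = ?R")
proof -
  have "\<mu> \<in> {\<mu> \<in> Cdual K. operator_norm K abs \<mu> \<le> 1} \<longleftrightarrow> \<mu> \<in> ?R" for \<mu>
  proof
    assume \<mu>: "\<mu> \<in> {\<mu> \<in> Cdual K. operator_norm K abs \<mu> \<le> 1}"
    then have "\<forall>f\<in>Cfun K. \<bar>\<mu> f\<bar> \<le> sup_norm K f"
      using operator_norm_abs_le_1_iff[OF K] by (auto simp: Cdual_def)
    then show "\<mu> \<in> ?R"
      using \<mu> by (auto simp: Cdual_def topspace_dual_cube PiE_iff abs_le_iff minus_le_iff)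
  next
    assume \<mu>: "\<mu> \<in> ?R"
    then have b: "\<forall>f\<in>Cfun K. \<bar>\<mu> f\<bar> \<le> sup_norm K f"
      by (force simp: topspace_dual_cube PiE_iff abs_le_iff)
    then have b1: "\<forall>f\<in>Cfun K. \<bar>\<mu> f\<bar> \<le> 1 * sup_norm K f"
      by simp
    then show "\<mu> \<in> {\<mu> \<in> Cdual K. operator_norm K abs \<mu> \<le> 1}"
      using \<mu> b operator_norm_abs_le_1_iff[OF K b1]
      by (auto simp: Cdual_def topspace_dual_cube PiE_iff intro!: exI[of _ 1])
  qed
  then show ?thesis
    unfolding topspace_M1_Cdual by blast
qed

lemma M1_subset_dual_cube: "compact_space K \<Longrightarrow> topspace (M1 K) \<subseteq> topspace (dual_cube K)"
  by (auto simp: topspace_M1)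

lemma M1_eq_subtopology:
  assumes "compact_space K"
  shows "M1 K = subtopology (dual_cube K) (topspace (M1 K))"
proof -
  let ?P = "product_topology (\<lambda>f. euclideanreal) (Cfun K)"
  have "Cdual K \<inter> {\<mu> \<in> Cdual K. operator_norm K abs \<mu> \<le> 1} = topspace (M1 K)"
    by (auto simp: topspace_M1_Cdual)
  then have "M1 K = subtopology ?P (topspace (M1 K))"
    by (simp only: M1_def weak_star_def subtopology_subtopology)
  also have "topspace (M1 K) = topspace (dual_cube K) \<inter> topspace (M1 K)"
    using M1_subset_dual_cube[OF assms] by blast
  also have "subtopology ?P \<dots> = subtopology (dual_cube K) (topspace (M1 K))"
    by (simp only: subtopology_subtopology[symmetric] dual_cube_eq_subtopology[symmetric])
  finally show ?thesis .
qed

lemma continuous_map_M1_eval: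
  assumes "compact_space K" "f \<in> Cfun K"
  shows "continuous_map (M1 K) euclideanreal (\<lambda>\<mu>. \<mu> f)"
  using continuous_map_from_subtopology[OF continuous_map_dual_cube_eval[OF assms(2)]]
  by (subst M1_eq_subtopology[OF assms(1)])

lemma continuous_map_into_M1_eval:
  assumes "compact_space K" "continuous_map X (M1 K) R" "f \<in> Cfun K"
  shows "continuous_map X euclideanreal (\<lambda>t. R t f)"
  using continuous_map_compose[OF assms(2) continuous_map_M1_eval[OF assms(1,3)]] by (simp add: o_def)

lemma closedin_M1:
  assumes K: "compact_space K"
  shows "closedin (dual_cube K) (topspace (M1 K))"
proof -
  let ?Q = "dual_cube K"
  have add: "closedin ?Q {z \<in> topspace ?Q. z (Cadd K f g) = z f + z g}"
    if "f \<in> Cfun K" "g \<in> Cfun K" for f g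
    using that by (intro closedin_continuous_maps_eq[where Y = euclideanreal] continuous_map_add
        continuous_map_dual_cube_eval Cadd_in_Cfun) auto
  have scale: "closedin ?Q {z \<in> topspace ?Q. z (Cscale K c f) = c * z f}"
    if "f \<in> Cfun K" for c f
    using that by (intro closedin_continuous_maps_eq[where Y = euclideanreal] continuous_map_real_mult_left
        continuous_map_dual_cube_eval Cscale_in_Cfun) auto
  have eq: "topspace (M1 K) = \<Inter>({topspace ?Q} \<union>
      (\<lambda>(f,g). {z \<in> topspace ?Q. z (Cadd K f g) = z f + z g}) ` (Cfun K \<times> Cfun K) \<union>
      (\<lambda>(c,f). {z \<in> topspace ?Q. z (Cscale K c f) = c * z f}) ` (UNIV \<times> Cfun K))"
    unfolding topspace_M1[OF K] by auto
  show ?thesis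
    unfolding eq by (rule closedin_Inter) (use add scale in auto)
qed

lemma compact_space_M1: "compact_space K \<Longrightarrow> compact_space (M1 K)"
  by (metis M1_eq_subtopology closedin_M1 closedin_compact_space compact_space_dual_cube
      compact_space_subtopology)

lemma Hausdorff_space_M1: "compact_space K \<Longrightarrow> Hausdorff_space (M1 K)"
  by (metis M1_eq_subtopology Hausdorff_space_dual_cube Hausdorff_space_subtopology)

lemma embedding_map_M1_dual_cube: 
  assumes K: "compact_space K" shows "embedding_map (M1 K) (dual_cube K) (\<lambda>\<mu>. \<mu>)"
  unfolding embedding_map_def
  using homeomorphic_map_id[of "M1 K" "M1 K"] M1_eq_subtopology[OF K] by (simp add: id_def)

section \<open>Dugundji dual balls are retracts of the cube\<close>

lemma absolute_retract_M1_retraction: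
  assumes K: "compact_space K" and A: "absolute_retract_space (M1 K)"
  shows "\<exists>R. continuous_map (dual_cube K) (M1 K) R \<and> (\<forall>\<mu>\<in>topspace (M1 K). R \<mu> = \<mu>)"
proof -
  have "topspace (M1 K) retract_of_space dual_cube K"
    using absolute_retract_space_any_type[OF compact_space_M1[OF K] Hausdorff_space_M1[OF K] A
        compact_space_dual_cube Hausdorff_space_dual_cube embedding_map_M1_dual_cube[OF K]] by simp
  then show ?thesis
    by (simp add: retract_of_space_def M1_eq_subtopology[OF K, symmetric])
qed

lemma zero_functional_in_M1:
  assumes K: "compact_space K"
  shows "(\<lambda>f\<in>Cfun K. 0) \<in> topspace (M1 K)"
  unfolding topspace_M1[OF K] topspace_dual_cube
  by (auto simp: Cadd_in_Cfun Cscale_in_Cfun sup_norm_ge_0[OF K])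

text \<open>
  For a point \<open>z\<close> of the cube, \<open>g \<mapsto> E g z\<close> is a probability measure on \<open>M1 K\<close>. Its barycentre is the
  functional \<open>f \<mapsto> E (ev f) z\<close>, where \<open>ev f\<close> is the evaluation \<open>\<mu> \<mapsto> \<mu> f\<close>; since \<open>f \<mapsto> ev f\<close> is linear
  and does not increase the norm, the barycentre lies in \<open>M1 K\<close>. For \<open>z \<in> M1 K\<close> the measure is the
  Dirac measure at \<open>z\<close>, so the barycentre is \<open>z\<close> itself.
\<close>

lemma dugundji_M1_retraction:
  assumes K: "compact_space K" and D: "dugundji_space (M1 K)"
  shows "\<exists>R. continuous_map (dual_cube K) (M1 K) R \<and> (\<forall>\<mu>\<in>topspace (M1 K). R \<mu> = \<mu>)"
proof -
  let ?M = "M1 K" and ?Q = "dual_cube K"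
  obtain E where E: "regular_extension_operator ?M ?Q (\<lambda>\<mu>. \<mu>) E"
    using dugundji_space_any_type[OF compact_space_M1[OF K] Hausdorff_space_M1[OF K] D
        compact_space_dual_cube Hausdorff_space_dual_cube embedding_map_M1_dual_cube[OF K]] by blast
  then have bE: "bounded_operator ?M ?Q E"
    and ext: "\<And>g \<mu>. \<lbrakk>g \<in> Cfun ?M; \<mu> \<in> topspace ?M\<rbrakk> \<Longrightarrow> E g \<mu> = g \<mu>"
    by (auto simp: regular_extension_operator_def extension_operator_def)
  have MQ: "topspace ?M \<subseteq> topspace ?Q"
    by (rule M1_subset_dual_cube[OF K])
  have neM: "topspace ?M \<noteq> {}"
    using zero_functional_in_M1[OF K] by blast
  then have "topspace ?Q \<noteq> {}"
    using MQ by blast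
  then have norm: "sup_norm ?Q (E g) \<le> sup_norm ?M g" if "g \<in> Cfun ?M" for g
    using operator_norm_eq_1_iff[OF compact_space_M1[OF K] neM, of ?Q E] E bE that
    by (auto simp: regular_extension_operator_def bounded_operator_def)
  define ev where "ev = (\<lambda>f. \<lambda>\<mu>\<in>topspace ?M. \<mu> f)"
  have ev: "ev f \<in> Cfun ?M" if "f \<in> Cfun K" for f
    unfolding ev_def by (rule restrict_in_Cfun[OF continuous_map_M1_eval[OF K that]])
  have ev_le: "sup_norm ?M (ev f) \<le> sup_norm K f" if "f \<in> Cfun K" for f
  proof (rule sup_norm_least)
    show "0 \<le> sup_norm K f"
      using sup_norm_ge_0[OF K that] .
    fix \<mu> assume "\<mu> \<in> topspace ?M"
    then have "\<mu> f \<in> {- sup_norm K f .. sup_norm K f}" "ev f \<mu> = \<mu> f"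
      using MQ that by (auto simp: topspace_dual_cube PiE_iff ev_def)
    then show "\<bar>ev f \<mu>\<bar> \<le> sup_norm K f"
      by (auto simp: abs_le_iff)
  qed
  have ev_add: "ev (Cadd K f g) = Cadd ?M (ev f) (ev g)" if "f \<in> Cfun K" "g \<in> Cfun K" for f g
    using that by (auto simp: ev_def Cadd_def[of ?M] topspace_M1[OF K] intro!: restrict_ext)
  have ev_scale: "ev (Cscale K c f) = Cscale ?M c (ev f)" if "f \<in> Cfun K" for c f
    using that by (auto simp: ev_def Cscale_def[of ?M] topspace_M1[OF K] intro!: restrict_ext)
  have EC: "E g \<in> Cfun ?Q" if "g \<in> Cfun ?M" for g
    using bE that by (auto simp: bounded_operator_def)
  define R where "R = (\<lambda>z. \<lambda>f\<in>Cfun K. E (ev f) z)"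
  have Rle: "R z f \<in> {- sup_norm K f .. sup_norm K f}" if "z \<in> topspace ?Q" "f \<in> Cfun K" for z f
  proof -
    have "\<bar>E (ev f) z\<bar> \<le> sup_norm ?Q (E (ev f))"
      using sup_norm_upper[OF compact_space_dual_cube EC[OF ev[OF that(2)]] that(1)] .
    then have "\<bar>E (ev f) z\<bar> \<le> sup_norm K f"
      using norm[OF ev[OF that(2)]] ev_le[OF that(2)] by linarith
    then show ?thesis
      using that by (auto simp: R_def abs_le_iff)
  qed
  have RM: "R z \<in> topspace ?M" if z: "z \<in> topspace ?Q" for z
    unfolding topspace_M1[OF K]
  proof (intro CollectI conjI ballI allI)
    show "R z \<in> topspace ?Q"
      unfolding topspace_dual_cube using Rle[OF z] by (auto simp: PiE_iff R_def)
    show "R z (Cadd K f g) = R z f + R z g" if "f \<in> Cfun K" "g \<in> Cfun K" for f g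
    proof -
      have "E (ev (Cadd K f g)) = Cadd ?Q (E (ev f)) (E (ev g))"
        using bE that ev by (simp add: ev_add bounded_operator_def)
      then show ?thesis
        using that z by (simp add: R_def Cadd_in_Cfun) (simp add: Cadd_def)
    qed
    show "R z (Cscale K c f) = c * R z f" if "f \<in> Cfun K" for c f
    proof -
      have "E (ev (Cscale K c f)) = Cscale ?Q c (E (ev f))"
        using bE that ev by (simp add: ev_scale bounded_operator_def)
      then show ?thesis
        using that z by (simp add: R_def Cscale_in_Cfun) (simp add: Cscale_def)
    qed
  qed
  have "continuous_map ?Q ?Q R"
  proof (rule continuous_map_into_dual_cube)
    show "R z \<in> topspace ?Q" if "z \<in> topspace ?Q" for z
      using RM[OF that] MQ by blast
    show "continuous_map ?Q euclideanreal (\<lambda>z. R z f)" if "f \<in> Cfun K" for f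
      using EC[OF ev[OF that]] that by (simp add: R_def Cfun_def)
  qed
  then have "continuous_map ?Q ?M R"
    using RM by (subst M1_eq_subtopology[OF K]) (auto simp: continuous_map_in_subtopology)
  moreover have "R \<mu> = \<mu>" if \<mu>: "\<mu> \<in> topspace ?M" for \<mu>
  proof (rule extensionalityI[of _ "Cfun K"])
    show "R \<mu> \<in> extensional (Cfun K)" "\<mu> \<in> extensional (Cfun K)"
      using \<mu> MQ by (auto simp: R_def topspace_dual_cube PiE_iff)
    show "R \<mu> f = \<mu> f" if "f \<in> Cfun K" for f
      using ext[OF ev[OF that] \<mu>] that \<mu> by (simp add: R_def ev_def)
  qed
  ultimately show ?thesis
    by blast
qed

section \<open>Separation of points and bump functions\<close>

text \<open>
  The family \<open>A\<close> embeds the compact space \<open>K\<close> into a countable product of lines.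
\<close>

lemma metrizable_if_countable_separating:
  assumes K: "compact_space K" and A: "countable A" "A \<subseteq> Cfun K"
    and sep: "\<And>x y. \<lbrakk>x \<in> topspace K; y \<in> topspace K; \<And>f. f \<in> A \<Longrightarrow> f x = f y\<rbrakk> \<Longrightarrow> x = y"
  shows "metrizable_space K"
proof -
  let ?P = "product_topology (\<lambda>f. euclideanreal) A"
  define e where "e = (\<lambda>x. \<lambda>f\<in>A. f x)"
  have cont: "continuous_map K ?P e"
    unfolding continuous_map_componentwise using A(2) by (auto simp: e_def Cfun_def subset_iff)
  have "inj_on e (topspace K)"
  proof (rule inj_onI)
    fix x y assume xy: "x \<in> topspace K" "y \<in> topspace K" "e x = e y"
    show "x = y"
    proof (rule sep[OF xy(1,2)])
      fix f assume "f \<in> A"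
      then show "f x = f y"
        using fun_cong[OF xy(3), of f] by (simp add: e_def)
    qed
  qed
  moreover have "Hausdorff_space ?P"
    by (simp add: Hausdorff_space_product_topology)
  ultimately have "embedding_map K ?P e"
    using continuous_imp_embedding_map[OF cont K] by blast
  then have "K homeomorphic_space subtopology ?P (e ` topspace K)"
    using embedding_map_imp_homeomorphic_space by blast
  moreover have "countable {f \<in> A. \<not> (\<exists>a. topspace euclideanreal \<subseteq> {a})}"
    using A(1) by (rule countable_subset[rotated]) auto
  then have "metrizable_space ?P"
    by (simp add: metrizable_space_product_topology metrizable_space_euclidean)
  ultimately show ?thesis
    using homeomorphic_metrizable_space metrizable_space_subtopology by blast
qed

lemma bump_function:
  assumes K: "compact_space K" "Hausdorff_space K"
    and C: "closedin K C" and x: "x \<in> topspace K" "x \<notin> C"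
  obtains h where "h \<in> Cfun K" "h x = 1" "\<And>t. t \<in> topspace K \<Longrightarrow> 0 \<le> h t \<and> h t \<le> 1"
    "\<And>t. t \<in> C \<Longrightarrow> h t = 0"
proof -
  have "normal_space K"
    using K compact_Hausdorff_or_regular_imp_normal_space by blast
  moreover have "closedin K {x}"
    using K(2) x by (simp add: closedin_Hausdorff_singleton)
  ultimately obtain h :: "'a \<Rightarrow> real"
    where h: "continuous_map K (top_of_set {0..1}) h" "h ` C \<subseteq> {0}" "h ` {x} \<subseteq> {1}"
    using Urysohn_lemma[of K C "{x}" 0 1] C x by auto
  have "continuous_map K euclideanreal h"
    using h(1) by (simp add: continuous_map_in_subtopology)
  then have "restrict h (topspace K) \<in> Cfun K"
    by (rule restrict_in_Cfun)
  moreover have "\<And>t. t \<in> topspace K \<Longrightarrow> 0 \<le> h t \<and> h t \<le> 1"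
    using h(1) by (auto simp: continuous_map_in_subtopology)
  moreover have "\<And>t. t \<in> C \<Longrightarrow> t \<in> topspace K"
    using C closedin_subset by blast
  ultimately show thesis
    using that[of "restrict h (topspace K)"] h x by auto
qed

text \<open>
  Every neighbourhood \<open>W\<close> of \<open>p\<close> contains another point, which can be separated from \<open>p\<close> inside \<open>W\<close>;
  the separating neighbourhood of \<open>p\<close> serves as the next \<open>W\<close>.
\<close>

lemma disjoint_open_sets_near_nonisolated_point:
  assumes H: "Hausdorff_space K" and V: "openin K V" "p \<in> V" and p: "\<not> openin K {p}"
  obtains U :: "nat \<Rightarrow> 'a set" where "\<And>n. openin K (U n)" "\<And>n. U n \<noteq> {}" "\<And>n. U n \<subseteq> V"
    "\<And>m n. m \<noteq> n \<Longrightarrow> U m \<inter> U n = {}"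
proof -
  \<comment> \<open>A state is a pair: the open set just chosen and the neighbourhood of \<open>p\<close> left for later choices.\<close>
  define P where "P = (\<lambda>S. openin K (fst S) \<and> openin K (snd S) \<and> fst S \<noteq> {} \<and> p \<in> snd S \<and>
    fst S \<inter> snd S = {} \<and> fst S \<union> snd S \<subseteq> V)"
  have step: "\<exists>S. P S \<and> fst S \<union> snd S \<subseteq> W" if W: "openin K W" "p \<in> W" "W \<subseteq> V" for W
  proof -
    have "W \<noteq> {p}"
      using p W(1) by blast
    then obtain a where a: "a \<in> W" "a \<noteq> p"
      using W(2) by blast
    then have "a \<in> topspace K" "p \<in> topspace K"
      using W openin_subset by blast+
    then obtain U1 W1 where UW: "openin K U1" "openin K W1" "a \<in> U1" "p \<in> W1" "disjnt U1 W1"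
      using H a unfolding Hausdorff_space_def by metis
    show ?thesis
      using UW W a by (intro exI[of _ "(U1 \<inter> W, W1 \<inter> W)"]) (auto simp: P_def disjnt_def)
  qed
  have "\<exists>f. \<forall>n. P (f n) \<and> fst (f (Suc n)) \<union> snd (f (Suc n)) \<subseteq> snd (f n)"
  proof (rule dependent_nat_choice)
    show "\<exists>S. P S"
      using step[OF V] by blast
    show "\<exists>T. P T \<and> fst T \<union> snd T \<subseteq> snd S" if "P S" for S and n :: nat
      using step[of "snd S"] that by (simp add: P_def)
  qed
  then obtain f where f: "\<And>n. P (f n)" "\<And>n. fst (f (Suc n)) \<union> snd (f (Suc n)) \<subseteq> snd (f n)"
    by blast
  have W: "snd (f n) \<subseteq> snd (f m)" if "m \<le> n" for m n
    by (rule lift_Suc_antimono_le[of "\<lambda>n. snd (f n)", OF _ that]) (use f(2) in blast)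
  have lt: "fst (f m) \<inter> fst (f n) = {}" if "m < n" for m n
  proof -
    obtain k where k: "n = Suc k" "m \<le> k"
      using \<open>m < n\<close> by (cases n) auto
    then have "fst (f n) \<subseteq> snd (f m)"
      using f(2)[of k] W[OF k(2)] by blast
    then show ?thesis
      using f(1)[of m] by (auto simp: P_def)
  qed
  show thesis
  proof
    show "openin K (fst (f n))" "fst (f n) \<noteq> {}" "fst (f n) \<subseteq> V" for n
      using f(1)[of n] by (auto simp: P_def)
    show "fst (f m) \<inter> fst (f n) = {}" if "m \<noteq> n" for m n
      using lt[of m n] lt[of n m] that by (cases m n rule: linorder_cases) auto
  qed
qed

definition disjoint_bumps ::
    "'a topology \<Rightarrow> 'a set \<Rightarrow> (nat \<Rightarrow> 'a \<Rightarrow> real) \<Rightarrow> (nat \<Rightarrow> 'a) \<Rightarrow> bool" where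
  "disjoint_bumps K V g a \<longleftrightarrow>
     (\<forall>n. g n \<in> Cfun K) \<and> (\<forall>n. a n \<in> topspace K) \<and> (\<forall>n. g n (a n) = 1) \<and>
     (\<forall>n. \<forall>t\<in>topspace K. 0 \<le> g n t) \<and> (\<forall>n. \<forall>t\<in>topspace K. g n t \<le> 1) \<and>
     (\<forall>n. \<forall>t\<in>topspace K. t \<notin> V \<longrightarrow> g n t = 0) \<and>
     (\<forall>n m. \<forall>t\<in>topspace K. n \<noteq> m \<longrightarrow> g n t = 0 \<or> g m t = 0)"

lemma disjoint_bumps_near_nonisolated_point:
  assumes K: "compact_space K" "Hausdorff_space K"
    and V: "openin K V" "p \<in> V" and p: "\<not> openin K {p}"
  shows "\<exists>g a. disjoint_bumps K V g a"
proof -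
  obtain U :: "nat \<Rightarrow> 'a set" where U: "\<And>n. openin K (U n)" "\<And>n. U n \<noteq> {}" "\<And>n. U n \<subseteq> V"
    "\<And>m n. m \<noteq> n \<Longrightarrow> U m \<inter> U n = {}"
    using disjoint_open_sets_near_nonisolated_point[OF K(2) V p] by blast
  define B where "B = (\<lambda>n S. snd S \<in> topspace K \<and> fst S \<in> Cfun K \<and> fst S (snd S) = (1::real) \<and>
    (\<forall>t\<in>topspace K. 0 \<le> fst S t \<and> fst S t \<le> 1 \<and> (t \<notin> U n \<longrightarrow> fst S t = 0)))"
  have "\<exists>S. B n S" for n
  proof -
    obtain a where a: "a \<in> U n"
      using U(2) by blast
    then have aK: "a \<in> topspace K"
      using U(1) openin_subset by blast
    obtain h where "h \<in> Cfun K" "h a = 1" "\<And>t. t \<in> topspace K \<Longrightarrow> 0 \<le> h t \<and> h t \<le> 1"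
        "\<And>t. t \<in> topspace K - U n \<Longrightarrow> h t = 0"
      using bump_function[OF K _ aK, of "topspace K - U n"] U(1) a by blast
    then show ?thesis
      using aK by (intro exI[of _ "(h, a)"]) (auto simp: B_def)
  qed
  then obtain S where S: "\<And>n. B n (S n)"
    by metis
  have "disjoint_bumps K V (\<lambda>n. fst (S n)) (\<lambda>n. snd (S n))"
    unfolding disjoint_bumps_def
  proof (intro conjI allI ballI impI)
    fix n m :: nat and t assume "n \<noteq> m" "t \<in> topspace K"
    then show "fst (S n) t = 0 \<or> fst (S m) t = 0"
      using S[of n] S[of m] U(4)[of n m] unfolding B_def by blast
  next
    fix n :: nat and t assume "t \<in> topspace K" "t \<notin> V"
    then show "fst (S n) t = 0"
      using S[of n] U(3)[of n] unfolding B_def by blast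
  qed (use S in \<open>auto simp: B_def\<close>)
  then show ?thesis
    by blast
qed

section \<open>Retractions onto the dual ball\<close>

lemma half_difference_in_M1:
  assumes K: "compact_space K" and ab: "a \<in> topspace K" "b \<in> topspace K"
  shows "(\<lambda>f\<in>Cfun K. (f a - f b) / 2) \<in> topspace (M1 K)"
proof -
  have "(f a - f b) / 2 \<in> {- sup_norm K f .. sup_norm K f}" if "f \<in> Cfun K" for f
    using sup_norm_upper[OF K that ab(1)] sup_norm_upper[OF K that ab(2)]
    by (simp add: abs_le_iff field_simps)
  moreover have "(\<lambda>f\<in>Cfun K. (f a - f b) / 2) (Cadd K f g) =
      (\<lambda>f\<in>Cfun K. (f a - f b) / 2) f + (\<lambda>f\<in>Cfun K. (f a - f b) / 2) g"
    if "f \<in> Cfun K" "g \<in> Cfun K" for f g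
    using that ab by (simp add: Cadd_in_Cfun) (simp add: Cadd_def field_simps)
  moreover have "(\<lambda>f\<in>Cfun K. (f a - f b) / 2) (Cscale K c f) = c * (\<lambda>f\<in>Cfun K. (f a - f b) / 2) f"
    if "f \<in> Cfun K" for c f
    using that ab by (simp add: Cscale_in_Cfun) (simp add: Cscale_def field_simps)
  ultimately show ?thesis
    unfolding topspace_M1[OF K] topspace_dual_cube by auto
qed

text \<open>
  The function \<open>g - g'\<close> has norm at most 1 and \<open>\<mu>\<close> attains its largest possible value 1 there. As \<open>h\<close>
  lives off the carriers of \<open>g\<close> and \<open>g'\<close>, the functions \<open>g - g' + h\<close> and \<open>g - g' - h\<close> still have norm
  at most 1, so \<open>\<mu> h\<close> can be neither positive nor negative.
\<close>

lemma norm_attaining_functional_vanishes_off_carriers: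
  assumes K: "compact_space K" and \<mu>: "\<mu> \<in> topspace (M1 K)"
    and C: "g \<in> Cfun K" "g' \<in> Cfun K" "h \<in> Cfun K"
    and val: "\<mu> g - \<mu> g' = 1"
    and g: "\<And>t. t \<in> topspace K \<Longrightarrow> 0 \<le> g t \<and> g t \<le> 1"
    and g': "\<And>t. t \<in> topspace K \<Longrightarrow> 0 \<le> g' t \<and> g' t \<le> 1"
    and h: "\<And>t. t \<in> topspace K \<Longrightarrow> \<bar>h t\<bar> \<le> 1"
    and disj: "\<And>t. t \<in> topspace K \<Longrightarrow> h t = 0 \<or> (g t = 0 \<and> g' t = 0)"
  shows "\<mu> h = 0"
proof -
  have le: "s * \<mu> h \<le> 0" if s: "\<bar>s\<bar> = 1" for s
  proof -
    define F where "F = Cadd K (Cadd K g (Cscale K (-1) g')) (Cscale K s h)"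
    have F: "F \<in> Cfun K"
      unfolding F_def using C by (intro Cadd_in_Cfun Cscale_in_Cfun)
    have "\<bar>F t\<bar> \<le> 1" if t: "t \<in> topspace K" for t
    proof -
      have "\<bar>s * h t\<bar> \<le> 1"
        using h[OF t] s by (simp add: abs_mult)
      moreover have "\<bar>g t - g' t\<bar> \<le> 1"
        using g[OF t] g'[OF t] by linarith
      moreover have "F t = g t - g' t + s * h t"
        using t by (simp add: F_def Cadd_def Cscale_def)
      ultimately show ?thesis
        using disj[OF t] by auto
    qed
    then have "sup_norm K F \<le> 1"
      by (intro sup_norm_least) auto
    moreover have "\<mu> F \<le> sup_norm K F"
      using \<mu> F by (auto simp: topspace_M1[OF K] topspace_dual_cube PiE_iff)
    moreover have "\<mu> F = \<mu> g - \<mu> g' + s * \<mu> h"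
      using \<mu> C by (simp add: F_def topspace_M1[OF K] Cadd_in_Cfun Cscale_in_Cfun)
    ultimately show ?thesis
      using val by simp
  qed
  show ?thesis
    using le[of 1] le[of "-1"] by simp
qed

text \<open>
  Omitting one point \<open>b\<close> from \<open>T\<close> does not change its accumulation points in a Hausdorff space. The
  exception is needed for sequences \<open>a\<close> where \<open>\<phi> (a m) = 0\<close> is known only for \<open>m \<noteq> n\<close>.
\<close>

lemma continuous_zero_at_accumulation_point:
  fixes \<phi> :: "'a \<Rightarrow> real"
  assumes H: "Hausdorff_space K" and \<phi>: "continuous_map K euclideanreal \<phi>"
    and c: "c \<in> K derived_set_of T" and zero: "\<And>t. \<lbrakk>t \<in> T; t \<noteq> b\<rbrakk> \<Longrightarrow> \<phi> t = 0"
  shows "\<phi> c = 0"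
proof (rule ccontr)
  assume nz: "\<phi> c \<noteq> 0"
  let ?O = "{t \<in> topspace K. \<phi> t \<in> - {0}}"
  have O: "openin K ?O"
    using \<phi> by (rule openin_continuous_map_preimage) auto
  have cK: "c \<in> topspace K"
    using c by (simp add: in_derived_set_of)
  define O' where "O' = (if b \<in> topspace K \<and> b \<noteq> c then ?O - {b} else ?O)"
  have "openin K O'"
    using O H by (auto simp: O'_def closedin_Hausdorff_singleton intro!: openin_diff)
  moreover have "c \<in> O'"
    using nz cK by (auto simp: O'_def)
  ultimately obtain t where t: "t \<noteq> c" "t \<in> T" "t \<in> O'"
    using c unfolding in_derived_set_of by blast
  then have "t \<noteq> b" "\<phi> t \<noteq> 0"
    by (auto simp: O'_def split: if_splits)
  then show False
    using zero t by blast
qed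

text \<open>
  The heart of the proof. The points \<open>z s t\<close> combine \<open>(\<delta>\<^sub>s - \<delta>\<^sub>t) / 2\<close> on \<open>A\<close> with
  \<open>(\<delta>\<^sub>x - \<delta>\<^sub>y) / 2\<close> off \<open>A\<close>, and \<open>\<phi> s t\<close> is the value of \<open>R (z s t)\<close> at a function \<open>h\<close> that is 1 at
  \<open>x\<close> and 0 on \<open>C\<close>. Distinct bumps force \<open>\<phi> (a n) (a m) = 0\<close>, the diagonal gives \<open>\<phi> c c = 1/2\<close>, and separate
  continuity of \<open>\<phi>\<close> at an accumulation point of the bumps makes the two clash.
\<close>

lemma no_retraction_with_bumps:
  assumes K: "compact_space K" "Hausdorff_space K"
    and R: "continuous_map (dual_cube K) (M1 K) R" "\<And>\<mu>. \<mu> \<in> topspace (M1 K) \<Longrightarrow> R \<mu> = \<mu>"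
    and A: "A \<subseteq> Cfun K"
    and RA: "self_supporting (dual_cube K) R A"
    and bumps: "disjoint_bumps K V g a" and gA: "range g \<subseteq> A"
    and xy: "x \<in> topspace K" "y \<in> topspace K" "\<forall>f\<in>A. f x = f y"
    and C: "closedin K C" "x \<notin> C" "y \<in> C" "V \<subseteq> C"
  shows False
proof -
  let ?Q = "dual_cube K" and ?M = "M1 K"
  have MQ: "topspace ?M \<subseteq> topspace ?Q"
    by (rule M1_subset_dual_cube[OF K(1)])
  have gC: "g n \<in> Cfun K" and aK: "a n \<in> topspace K" and ga: "g n (a n) = 1"
    and g01: "t \<in> topspace K \<Longrightarrow> 0 \<le> g n t \<and> g n t \<le> 1"
    and gV: "t \<in> topspace K \<Longrightarrow> t \<notin> V \<Longrightarrow> g n t = 0"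
    and disj: "t \<in> topspace K \<Longrightarrow> n \<noteq> m \<Longrightarrow> g n t = 0 \<or> g m t = 0" for n m t
    using bumps unfolding disjoint_bumps_def by blast+
  obtain h where h: "h \<in> Cfun K" "h x = 1" "\<And>t. t \<in> topspace K \<Longrightarrow> 0 \<le> h t \<and> h t \<le> 1"
      "\<And>t. t \<in> C \<Longrightarrow> h t = 0"
    using bump_function[OF K C(1) xy(1) C(2)] by blast
  define d where "d = (\<lambda>s t. \<lambda>f\<in>Cfun K. (f s - f t) / 2)"
  define z where "z = (\<lambda>s t. \<lambda>f\<in>Cfun K. if f \<in> A then d s t f else d x y f)"
  have dM: "d s t \<in> topspace ?M" if "s \<in> topspace K" "t \<in> topspace K" for s t
    unfolding d_def by (rule half_difference_in_M1[OF K(1) that])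
  have dQ: "d s t \<in> topspace ?Q" if "s \<in> topspace K" "t \<in> topspace K" for s t
    using dM[OF that] MQ by blast
  have zQ: "z s t \<in> topspace ?Q" if "s \<in> topspace K" "t \<in> topspace K" for s t
    using dQ[OF that] dQ[OF xy(1,2)] by (auto simp: z_def topspace_dual_cube PiE_iff)
  \<comment> \<open>Both \<open>d c c\<close> and \<open>d x y\<close> vanish on \<open>A\<close>, the latter because \<open>A\<close> does not separate \<open>x\<close> and \<open>y\<close>.\<close>
  have z_diag: "z c c = d x y" for c
    by (rule extensionalityI[of _ "Cfun K"]) (auto simp: z_def d_def xy(3)[rule_format])
  have Rh: "continuous_map ?Q euclideanreal (\<lambda>w. R w h)"
    by (rule continuous_map_into_M1_eval[OF K(1) R(1) h(1)])
  define \<phi> where "\<phi> = (\<lambda>s t. R (z s t) h)"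
  have Cfun_cont: "continuous_map K euclideanreal f" if "f \<in> Cfun K" for f
    using that by (simp add: Cfun_def)
  have cont2: "continuous_map K euclideanreal (\<phi> s)" if s: "s \<in> topspace K" for s
  proof -
    have "continuous_map K ?Q (z s)"
    proof (rule continuous_map_into_dual_cube)
      fix f assume f: "f \<in> Cfun K"
      have "continuous_map K euclideanreal (\<lambda>t. (f s - f t) / 2)"
        by (intro continuous_intros Cfun_cont f) auto
      then show "continuous_map K euclideanreal (\<lambda>t. z s t f)"
        using f by (simp add: z_def d_def)
    qed (use zQ s in auto)
    then show ?thesis
      using continuous_map_compose[OF _ Rh] by (simp add: \<phi>_def o_def)
  qed
  have cont1: "continuous_map K euclideanreal (\<lambda>s. \<phi> s t)" if t: "t \<in> topspace K" for t
  proof -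
    have "continuous_map K ?Q (\<lambda>s. z s t)"
    proof (rule continuous_map_into_dual_cube)
      fix f assume f: "f \<in> Cfun K"
      have "continuous_map K euclideanreal (\<lambda>s. (f s - f t) / 2)"
        by (intro continuous_intros Cfun_cont f) auto
      then show "continuous_map K euclideanreal (\<lambda>s. z s t f)"
        using f by (simp add: z_def d_def)
    qed (use zQ t in auto)
    then show ?thesis
      using continuous_map_compose[OF _ Rh] by (simp add: \<phi>_def o_def)
  qed
  have ga0: "g n (a m) = 0" if "n \<noteq> m" for n m
    using disj[OF aK[of m] that] ga[of m] by auto
  have zero: "\<phi> (a n) (a m) = 0" if nm: "n \<noteq> m" for n m
  proof -
    let ?z = "z (a n) (a m)" and ?d = "d (a n) (a m)"
    \<comment> \<open>\<open>?z\<close> and the functional \<open>?d\<close>, a fixed point of \<open>R\<close>, agree on the coordinates in \<open>A\<close>.\<close>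
    have Rg: "R ?z (g k) = ?d (g k)" for k
    proof -
      have "R ?z (g k) = R ?d (g k)"
      proof (rule RA[unfolded self_supporting_def, rule_format])
        show "g k \<in> A"
          using gA by blast
        show "?z f = ?d f" if "f \<in> A" for f
          using that A by (auto simp: z_def)
      qed (use zQ dQ aK in auto)
      then show ?thesis
        using R(2)[OF dM[OF aK aK]] by simp
    qed
    have "R ?z \<in> topspace ?M"
      using R(1) zQ[OF aK aK] by (auto simp: continuous_map_def)
    moreover have "R ?z (g n) - R ?z (g m) = 1"
      unfolding Rg using nm gC ga ga0[of n m] ga0[of m n] by (simp add: d_def)
    moreover have "h t = 0 \<or> (g n t = 0 \<and> g m t = 0)" if "t \<in> topspace K" for t
      using gV[OF that] h(4)[of t] C(4) by blast
    ultimately have "R ?z h = 0"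
      using h(3) by (intro norm_attaining_functional_vanishes_off_carriers[OF K(1) _ gC gC h(1)])
        (auto simp: g01)
    then show ?thesis
      by (simp add: \<phi>_def)
  qed
  have "inj a"
    using ga ga0 by (intro injI) (metis zero_neq_one)
  then have "infinite (range a)"
    by (rule range_inj_infinite)
  then obtain c where c: "c \<in> topspace K" "c \<in> K derived_set_of (range a)"
    using compactin_imp_Bolzano_Weierstrass[of K "topspace K" "range a"] K(1) aK
    unfolding compact_space_def by blast
  \<comment> \<open>The limit is taken in one variable at a time.\<close>
  have "\<phi> (a n) c = 0" for n
  proof (rule continuous_zero_at_accumulation_point[OF K(2) cont2[OF aK[of n]] c(2)])
    fix t assume "t \<in> range a" "t \<noteq> a n"
    then obtain m where "t = a m" "n \<noteq> m"
      by blast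
    then show "\<phi> (a n) t = 0"
      using zero by simp
  qed
  then have "\<phi> c c = 0"
    by (intro continuous_zero_at_accumulation_point[OF K(2) cont1[OF c(1)] c(2), of c]) auto
  moreover have "\<phi> c c = 1/2"
    using h C(3) by (simp add: \<phi>_def z_diag R(2)[OF dM[OF xy(1,2)]]) (simp add: d_def)
  ultimately show False
    by simp
qed

text \<open>
  The bumps, and in the first case a function \<open>u\<close>, are put into \<open>A\<close> first; then \<open>x\<close>, \<open>y\<close> arise from the
  failure of \<open>A\<close> to separate points. What remains is a closed set \<open>C\<close> containing \<open>y\<close> and the carriers of
  infinitely many of the bumps, but not \<open>x\<close>.
\<close>

lemma no_retraction_onto_M1:
  assumes K: "compact_space K" "Hausdorff_space K" and nm: "\<not> metrizable_space K"
    and R: "continuous_map (dual_cube K) (M1 K) R" "\<And>\<mu>. \<mu> \<in> topspace (M1 K) \<Longrightarrow> R \<mu> = \<mu>"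
  shows False
proof -
  define glues where "glues = (\<lambda>A x y. A \<subseteq> Cfun K \<and>
      self_supporting (dual_cube K) R A \<and>
      x \<in> topspace K \<and> y \<in> topspace K \<and> x \<noteq> y \<and> (\<forall>f\<in>A. f x = f y))"
  have coords: "\<exists>A x y. A0 \<subseteq> A \<and> glues A x y" if A0: "countable A0" "A0 \<subseteq> Cfun K" for A0
  proof -
    have "\<exists>A. countable A \<and> A0 \<subseteq> A \<and> A \<subseteq> Cfun K \<and>
      self_supporting (dual_cube K) R A"
      using continuous_map_into_M1_eval[OF K(1) R(1)] unfolding dual_cube_def
      by (intro countable_self_supporting_coordinates A0) (auto simp: compact_space_subtopology)
    then obtain A where A: "countable A" "A0 \<subseteq> A" "A \<subseteq> Cfun K"
      "self_supporting (dual_cube K) R A"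
      by blast
    obtain x y where "x \<in> topspace K" "y \<in> topspace K" "x \<noteq> y" "\<forall>f\<in>A. f x = f y"
      using metrizable_if_countable_separating[OF K(1) A(1,3)] nm by blast
    with A show ?thesis
      unfolding glues_def by (intro exI[of _ A] exI[of _ x] exI[of _ y]) simp
  qed
  have bumps_Cfun: "range g \<subseteq> Cfun K" if "disjoint_bumps K V g a" for V g a
    using that by (auto simp: disjoint_bumps_def)
  have "K \<noteq> discrete_topology (topspace K)"
    using nm metrizable_space_discrete_topology by metis
  then obtain p where p: "p \<in> topspace K" "\<not> openin K {p}"
    using discrete_topology_unique by metis
  show False
  proof (cases "\<exists>q\<in>topspace K. q \<noteq> p \<and> \<not> openin K {q}")
    case True
    then obtain q where q: "q \<in> topspace K" "q \<noteq> p" "\<not> openin K {q}"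
      by blast
    have p_closed: "closedin K {p}" and "q \<notin> {p}"
      using K(2) p(1) q(2) by (simp_all add: closedin_Hausdorff_singleton)
    then obtain u where u: "u \<in> Cfun K" "u q = 1" "u p = 0"
      using bump_function[OF K p_closed q(1)] by (metis singletonI)
    have uc: "continuous_map K euclideanreal u"
      using u(1) by (simp add: Cfun_def)
    let ?V = "{t \<in> topspace K. u t \<in> {..<1/3}}" and ?W = "{t \<in> topspace K. u t \<in> {2/3<..}}"
    have "openin K ?V" "openin K ?W"
      by (rule openin_continuous_map_preimage[OF uc]; simp)+
    moreover have "p \<in> ?V" "q \<in> ?W"
      using p(1) q(1) u(2,3) by simp_all
    ultimately have "\<exists>g a. disjoint_bumps K ?V g a" "\<exists>g a. disjoint_bumps K ?W g a"
      using disjoint_bumps_near_nonisolated_point[OF K] p(2) q(3) by simp_all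
    then obtain g a g' a' where g: "disjoint_bumps K ?V g a" and g': "disjoint_bumps K ?W g' a'"
      by blast
    have "countable (insert u (range g \<union> range g'))" "insert u (range g \<union> range g') \<subseteq> Cfun K"
      using bumps_Cfun[OF g] bumps_Cfun[OF g'] u(1) by auto
    then have "\<exists>A x y. insert u (range g \<union> range g') \<subseteq> A \<and> glues A x y"
      by (rule coords)
    then obtain A x y where A0: "insert u (range g \<union> range g') \<subseteq> A" and "glues A x y"
      by (elim exE conjE)
    then have A: "A \<subseteq> Cfun K" "self_supporting (dual_cube K) R A"
      and xy: "x \<in> topspace K" "y \<in> topspace K" "x \<noteq> y" "\<forall>f\<in>A. f x = f y"
      unfolding glues_def by blast+
    have uxy: "u x = u y"
      using A0 xy(4) by blast
    have y: "closedin K {y}"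
      using K(2) xy(2) by (simp add: closedin_Hausdorff_singleton)
    \<comment> \<open>The common value \<open>u x = u y\<close> lies outside \<open>{..1/3}\<close> or outside \<open>{2/3..}\<close>; the bumps of that side are used.\<close>
    show False
    proof (cases "u x \<le> 1/2")
      case True
      let ?C = "{t \<in> topspace K. u t \<in> {2/3..}} \<union> {y}"
      have "closedin K ?C"
        by (intro closedin_Un y closedin_continuous_map_preimage[OF uc]) simp
      moreover have "?W \<subseteq> ?C" "x \<notin> ?C"
        using True xy(3) by auto
      ultimately show False
        using A0 by (intro no_retraction_with_bumps[OF K R A g' _ xy(1,2,4)]) auto
    next
      case False
      let ?C = "{t \<in> topspace K. u t \<in> {..1/3}} \<union> {y}"
      have "closedin K ?C"
        by (intro closedin_Un y closedin_continuous_map_preimage[OF uc]) simp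
      moreover have "?V \<subseteq> ?C" "x \<notin> ?C"
        using False xy(3) by auto
      ultimately show False
        using A0 by (intro no_retraction_with_bumps[OF K R A g _ xy(1,2,4)]) auto
    qed
  next
    case False
    obtain g a where g: "disjoint_bumps K (topspace K) g a"
      using disjoint_bumps_near_nonisolated_point[OF K openin_topspace p] by blast
    obtain A x' y' where A0: "range g \<subseteq> A" and "glues A x' y'"
      using coords[OF countable_image[OF countableI_type] bumps_Cfun[OF g]] by (elim exE conjE)
    then have A: "A \<subseteq> Cfun K" "self_supporting (dual_cube K) R A"
      and xy': "x' \<in> topspace K" "y' \<in> topspace K" "x' \<noteq> y'" "\<forall>f\<in>A. f x' = f y'"
      unfolding glues_def by blast+
    obtain x y where xy: "x \<in> topspace K" "y \<in> topspace K" "x \<noteq> y" "\<forall>f\<in>A. f x = f y" "x \<noteq> p"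
    proof (cases "x' = p")
      case True
      show thesis
        using xy' True by (intro that[of y' x']) metis+
    next
      case False
      show thesis
        using xy' False by (intro that[of x' y']) metis+
    qed
    \<comment> \<open>The point \<open>x\<close> is isolated, and at most one of the disjoint bumps is nonzero there.\<close>
    have C: "closedin K (topspace K - {x})"
      using False xy(1,5) by blast
    obtain N where N: "\<And>n. g (n + N) x = 0"
    proof (cases "\<exists>m. g m x \<noteq> 0")
      case True
      then obtain m where m: "g m x \<noteq> 0"
        by blast
      have "g (n + Suc m) x = 0" for n
      proof -
        have "g (n + Suc m) x = 0 \<or> g m x = 0"
          using g xy(1) unfolding disjoint_bumps_def by (metis less_add_Suc2 less_irrefl)
        then show ?thesis
          using m by blast
      qed
      then show thesis
        by (rule that)
    next
      case False
      then show thesis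
        by (intro that[of 0]) auto
    qed
    have g': "disjoint_bumps K (topspace K - {x}) (\<lambda>n. g (n + N)) (\<lambda>n. a (n + N))"
      using g N by (auto simp: disjoint_bumps_def)
    have "range (\<lambda>n. g (n + N)) \<subseteq> A"
      using A0 by blast
    then show False
      using no_retraction_with_bumps[OF K R A g' _ xy(1,2,4) C] xy(2,3) by blast
  qed
qed

theorem theorem6p1:
  fixes K :: "'a topology"
  assumes "compact_space K" and "Hausdorff_space K" and "\<not> metrizable_space K"
  shows "\<not> dugundji_space (M1 K) \<and> \<not> absolute_retract_space (M1 K)"
proof -
  have "\<not> (\<exists>R. continuous_map (dual_cube K) (M1 K) R \<and> (\<forall>\<mu>\<in>topspace (M1 K). R \<mu> = \<mu>))"
    using no_retraction_onto_M1[OF assms] by blast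
  then show ?thesis
    using dugundji_M1_retraction[OF assms(1)] absolute_retract_M1_retraction[OF assms(1)] by blast
qed

end
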